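(* Let $\lambda,V,\theta_{\mathrm{up}}>0$, $c_1,c_2\ge0$, let $F_\Theta$ be the cumulative distribution function of the uniform distribution on $[0,\theta_{\mathrm{up}}]$, and let $\mathbf{E}[T(p)]$, $\mathbf{E}[X]$, $\mathbf{E}[X_e]$ be as in the context. Put $$\theta_2^*=\frac{V-c_2}{\mathbf{E}[X]},\qquad \bar\theta(p)=\frac{c_2-c_1}{\mathbf{E}[T(p)]-\mathbf{E}[X]},$$ and suppose $0<\bar\theta(p^\epsilon)<\theta_2^*$, where $p^\epsilon=\min\{1,\frac1{\lambda\mathbf{E}[X_e]}-\epsilon\}$ with $\epsilon>0$ sufficiently small. Let $\alpha\in(0,1]$, let $(p_1^0,p_2^0)\in[0,1]^2$ be any starting point, and consider the dynamics $$(p_1^{t+1},p_2^{t+1})=(1-\alpha)(p_1^t,p_2^t)+\alpha\Bigl(F_\Theta\bigl(\bar\theta(p_1^t)\bigr),\;F_\Theta(\theta_2^* )-F_\Theta\bigl(\bar\theta(p_1^t)\bigr)\Bigr),\quad t=0,1,2,\dots$$ If $$\frac{\mathbf{E}'[T(1)]}{\mathbf{E}[T(1)]-\mathbf{E}[X]}<\frac1\alpha,$$ where $\mathbf{E}'[T(1)]$ is the derivative of $p\mapsto\mathbf{E}[T(p)]$ at $p=1$, then $(p_1^t,p_2^t)$ converges as $t\to\infty$ to the equilibrium $(p_1^*,p_2^* )$, i.e. the unique pair with $p_1^*\in[0,1]$, $p_1^*=F_\Theta(\bar\theta(p_1^* ))$ and $p_2^*=F_\Theta(\theta_2^* )-F_\Theta(\bar\theta(p_1^*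 ))$.
   Context: Secondary users (SUs) arrive according to a Poisson process of rate $\lambda>0$. Each SU carries a job with random service time $X>0$. Its type $\theta$ (delay sensitivity) is drawn from the uniform distribution on $[0,\theta_{\mathrm{up}}]$, with cumulative distribution function $F_\Theta$ (so $F_\Theta(x)=0$ for $x\le 0$, $F_\Theta(x)=x/\theta_{\mathrm{up}}$ on $[0,\theta_{\mathrm{up}}]$, and $F_\Theta(x)=1$ for $x\ge\theta_{\mathrm{up}}$). Two operators are present: a shared-use operator with admission price $c_1$ and an exclusive-use operator with admission price $c_2$; $V$ is the service reward. The shared-use operator has a single channel alternating between ON periods (i.i.d. copies $Y_i$ of $Y>0$, during which SU service is interrupted) and OFF periods (i.i.d. copies of $Z>0$), independent of SU arrivals and service times. The effective service time is $X_e=X+\sum_{i=1}^{N(X)}Y_i$, where $N(X)$ is the number of ON periods interrupting the service. One has $\mathbf{E}[X_e]=\mathbf{E}[X]\,(1+\mathbf{E}[Y]/\mathbf{E}[Z])>\mathbf{E}[X]>0$, and $\mathbf{E}[X_e^2]$ is positive and finite. If a fraction $p\in[0,1]$ of SUs joins the shared-use operator, its mean queueing delay is $$\mathbf{E}[T(p)]=\begin{cases}\dfrac{\lambda p\,\mathbf{E}[X_e^2]}{2(1-\lambda p\,\mathbf{E}[X_e])}+\mathbf{E}[X_e], & \lambda p<1/\mathbf{E}[X_e],\\[2mm] \infty, & \text{otherwise,}\end{cases}$$ with the convention $a/\infty=0$. The exclusive-use operator's delay is always $\mathbf{E}[X]$. $\mathbf{E}'[T(p)]$ denotes the derivative of $\mathbf{E}[T(p)]$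 with respect to $p$ (given by the finite formula). If $\lambda\ge1/\mathbf{E}[X_e]$, the left side of the displayed condition is interpreted as $+\infty$, so the condition is then violated. $p_1^t,p_2^t$ are the fractions of SUs joining the shared-use and exclusive-use operators in period $t$. *)

theory Defs
  imports "HOL-Probability.Probability"
begin

text \<open>
  Service of one job on a channel that alternates between ON periods (service suspended) and OFF
  periods (service in progress). \<open>X\<close> is the service time, \<open>R\<close> the amount of service received before
  the first interruption (the remainder of the OFF period in which service begins), \<open>Y i\<close> the
  \<open>(i+1)\<close>-st interrupting ON period and \<open>Z i\<close> the OFF period following it. Measured in service
  received, the \<open>(n+1)\<close>-st interruption thus occurs at \<open>R + Z 0 + \<dots> + Z (n - 1)\<close>.
\<close>

definition interruptions ::
    "('a \<Rightarrow> real) \<Rightarrow> (nat \<Rightarrow> 'a \<Rightarrow> real) \<Rightarrow> real \<Rightarrow> 'a \<Rightarrow> nat" where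
  "interruptions R Z x \<omega> = card {n. R \<omega> + (\<Sum>i<n. Z i \<omega>) < x}"

definition effective_service ::
    "('a \<Rightarrow> real) \<Rightarrow> ('a \<Rightarrow> real) \<Rightarrow> (nat \<Rightarrow> 'a \<Rightarrow> real) \<Rightarrow> (nat \<Rightarrow> 'a \<Rightarrow> real) \<Rightarrow> 'a \<Rightarrow> real" where
  "effective_service X R Y Z \<omega> = X \<omega> + (\<Sum>i<interruptions R Z (X \<omega>) \<omega>. Y i \<omega>)"

datatype duration = Service | Initial | On nat | Off nat

text \<open>
  The law of \<open>R\<close> is left open. Assumption \<open>mean_effective\<close> is the stationary relation
  between the mean service times; it holds when \<open>R\<close> has the equilibrium residual law of \<open>Z 0\<close>
  (for exponential OFF periods, the law of \<open>Z 0\<close> itself).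
\<close>

locale interrupted_service = prob_space M
  for M :: "'a measure" +
  fixes X R :: "'a \<Rightarrow> real" and Y Z :: "nat \<Rightarrow> 'a \<Rightarrow> real"
  assumes indep: "indep_vars (\<lambda>_. borel)
      (\<lambda>k. case k of Service \<Rightarrow> X | Initial \<Rightarrow> R | On i \<Rightarrow> Y i | Off i \<Rightarrow> Z i) UNIV"
    and ident_Y: "distr M borel (Y i) = distr M borel (Y 0)"
    and ident_Z: "distr M borel (Z i) = distr M borel (Z 0)"
    and pos_X: "AE \<omega> in M. 0 < X \<omega>"
    and nonneg_R: "AE \<omega> in M. 0 \<le> R \<omega>"
    and pos_Y: "AE \<omega> in M. 0 < Y i \<omega>"
    and pos_Z: "AE \<omega> in M. 0 < Z i \<omega>"
    and integrable_X: "integrable M X"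
    and integrable_Y: "integrable M (Y 0)"
    and integrable_Z: "integrable M (Z 0)"
    and integrable_effective_sq: "integrable M (\<lambda>\<omega>. (effective_service X R Y Z \<omega>)\<^sup>2)"
    and mean_effective: "expectation (effective_service X R Y Z) =
      expectation X * (1 + expectation (Y 0) / expectation (Z 0))"

text \<open>Pollaczek--Khinchine formula; \<open>m1\<close> and \<open>m2\<close> are the first two moments of the effective
  service time.\<close>

definition mean_delay :: "real \<Rightarrow> real \<Rightarrow> real \<Rightarrow> real \<Rightarrow> ereal" where
  "mean_delay lam m1 m2 p =
     (if lam * p < 1 / m1 then ereal (lam * p * m2 / (2 * (1 - lam * p * m1)) + m1) else \<infinity>)"

text \<open>In the remaining definitions \<open>T\<close> is the mean delay of the shared-use operator as a function
  of the joining fraction, and \<open>m\<close> is the mean of the uninterrupted service time.\<close>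

definition theta2_star :: "real \<Rightarrow> real \<Rightarrow> real \<Rightarrow> real" where
  "theta2_star V c2 m = (V - c2) / m"

text \<open>Division by \<open>\<infinity>\<close> is \<open>0\<close> in \<^typ>\<open>ereal\<close>, so the value is \<open>0\<close> where \<open>T p = \<infinity>\<close>.\<close>

definition theta_bar :: "(real \<Rightarrow> ereal) \<Rightarrow> real \<Rightarrow> real \<Rightarrow> real \<Rightarrow> real \<Rightarrow> real" where
  "theta_bar T m c1 c2 p = real_of_ereal (ereal (c2 - c1) / (T p - ereal m))"

definition type_cdf :: "real \<Rightarrow> real \<Rightarrow> real" where
  "type_cdf \<theta>up = cdf (uniform_measure lborel {0..\<theta>up})"

definition p_eps :: "real \<Rightarrow> real \<Rightarrow> real \<Rightarrow> real" where
  "p_eps lam m1 \<epsilon> = min 1 (1 / (lam * m1) - \<epsilon>)"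

text \<open>The ratio of \<open>T'(1)\<close> to \<open>T(1) - m\<close>, read as \<open>\<infinity>\<close> for an overloaded queue. If \<open>T 1\<close> is finite
  then so is \<open>T\<close> near \<open>1\<close>, and the derivative is that of the finite formula.\<close>

definition delay_ratio :: "(real \<Rightarrow> ereal) \<Rightarrow> real \<Rightarrow> ereal" where
  "delay_ratio T m =
     (if T 1 = \<infinity> then \<infinity> else ereal (deriv (\<lambda>p. real_of_ereal (T p)) 1) / (T 1 - ereal m))"

definition best_response ::
    "real \<Rightarrow> (real \<Rightarrow> ereal) \<Rightarrow> real \<Rightarrow> real \<Rightarrow> real \<Rightarrow> real \<Rightarrow> real \<Rightarrow> real \<times> real" where
  "best_response \<theta>up T m V c1 c2 p =
     (type_cdf \<theta>up (theta_bar T m c1 c2 p),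
      type_cdf \<theta>up (theta2_star V c2 m) - type_cdf \<theta>up (theta_bar T m c1 c2 p))"

definition equilibrium ::
    "real \<Rightarrow> (real \<Rightarrow> ereal) \<Rightarrow> real \<Rightarrow> real \<Rightarrow> real \<Rightarrow> real \<Rightarrow> real \<times> real \<Rightarrow> bool" where
  "equilibrium \<theta>up T m V c1 c2 e \<longleftrightarrow>
     fst e \<in> {0..1} \<and> e = best_response \<theta>up T m V c1 c2 (fst e)"

end

theory Submission imports Defs
begin

text \<open>
  Let \<open>f\<close> be the update map of \<open>p\<^sub>1\<close> and \<open>D = E[T] - E[X]\<close>. If \<open>u < v \<le> f u\<close> and \<open>f v \<le> u\<close>, then
  \<open>(v - (1 - \<alpha>) u) D(u) \<le> (u - (1 - \<alpha>) v) D(v)\<close>. The difference of the two sides is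
  \<open>(v - u) / ((1 - b u) (1 - b v))\<close>, with \<open>b = \<lambda> E[X\<^sub>e]\<close>, times a form affine in each of \<open>u\<close> and \<open>v\<close>, which
  the ratio condition makes positive. So \<open>f\<close> has no such pair, in particular no 2-cycle, and in one
  dimension this forces every orbit to converge to the fixed point, although \<open>f\<close> need not be monotone
  or a contraction. The sum \<open>p\<^sub>1 + p\<^sub>2\<close> obeys a linear recursion.
\<close>

section \<open>Subsequential limits of orbits of a continuous interval map\<close>

lemma bounded_sequence_extreme_subseq_limits:
  fixes x :: "nat \<Rightarrow> real"
  assumes "\<And>t. x t \<in> {lo..hi}"
  obtains l L r s where "strict_mono r" "(x \<circ> r) \<longlonglongrightarrow> l" "strict_mono s" "(x \<circ> s) \<longlonglongrightarrow> L"
    "\<And>q a. strict_mono q \<Longrightarrow> (x \<circ> q) \<longlonglongrightarrow> a \<Longrightarrow> l \<le> a \<and> a \<le> L"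
    "l = L \<Longrightarrow> x \<longlonglongrightarrow> l"
proof -
  \<comment> \<open>In \<open>ereal\<close> the liminf and limsup always exist; the bounds
    \<open>lo\<close> and \<open>hi\<close> make them finite, so they come back as reals
    \<open>l\<close> and \<open>L\<close>.\<close>
  define X where "X = (\<lambda>t. ereal (x t))"
  have lo: "ereal lo \<le> liminf X" and hi: "limsup X \<le> ereal hi"
    using assms by (auto intro!: Liminf_bounded Limsup_bounded simp: X_def)
  have le: "liminf X \<le> limsup X" by (simp add: Liminf_le_Limsup)
  have "\<bar>liminf X\<bar> \<noteq> \<infinity>" "\<bar>limsup X\<bar> \<noteq> \<infinity>" using lo hi le by auto
  then obtain l L where l: "liminf X = ereal l" and L: "limsup X = ereal L" by auto
  obtain r where r: "strict_mono r" "(X \<circ> r) \<longlonglongrightarrow> ereal l" using liminf_subseq_lim[of X] l by auto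
  obtain s where s: "strict_mono s" "(X \<circ> s) \<longlonglongrightarrow> ereal L" using limsup_subseq_lim[of X] L by auto
  show ?thesis
  proof (rule that[of r l s L])
    show "strict_mono r" "(x \<circ> r) \<longlonglongrightarrow> l" "strict_mono s" "(x \<circ> s) \<longlonglongrightarrow> L"
      using r s by (auto simp: X_def o_def)
    fix q a assume q: "strict_mono q" "(x \<circ> q) \<longlonglongrightarrow> a"
    have "(X \<circ> q) \<longlonglongrightarrow> ereal a" using q(2) by (simp add: X_def o_def)
    then have "liminf (X \<circ> q) = ereal a" "limsup (X \<circ> q) = ereal a"
      by (auto intro: lim_imp_Liminf lim_imp_Limsup)
    then show "l \<le> a \<and> a \<le> L"
      using liminf_subseq_mono[OF q(1), of X] limsup_subseq_mono[OF q(1), of X] l L by simp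
  next
    assume "l = L"
    then have "X \<longlonglongrightarrow> ereal l" using l L by (intro Liminf_eq_Limsup) auto
    then show "x \<longlonglongrightarrow> l" by (simp add: X_def)
  qed
qed

text \<open>Move the subsequence back by one time step. By compactness the predecessors cluster at
  some \<open>b\<close>, and continuity of \<open>f\<close> carries this cluster point to
  \<open>l\<close>.\<close>

lemma orbit_limit_has_preimage_limit:
  fixes x :: "nat \<Rightarrow> real"
  assumes cont: "continuous_on {lo..hi} f"
    and range: "\<And>t. x t \<in> {lo..hi}"
    and step: "\<And>t. x (Suc t) = f (x t)"
    and r: "strict_mono r" "(x \<circ> r) \<longlonglongrightarrow> l"
  obtains q b where "strict_mono q" "(x \<circ> q) \<longlonglongrightarrow> b" "b \<in> {lo..hi}" "f b = l"
proof -
  \<comment> \<open>\<open>r 0\<close> may be 0 and then has no predecessor, so the indices start at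
    \<open>r 1\<close>, which is positive.\<close>
  define u where "u n = r (Suc n) - 1" for n
  have Su: "Suc (u n) = r (Suc n)" for n
    using strict_mono_imp_increasing[OF r(1), of "Suc n"] by (simp add: u_def)
  have u: "strict_mono u"
    unfolding strict_mono_Suc_iff
  proof
    fix n
    have "r (Suc n) < r (Suc (Suc n))" using r(1) by (simp add: strict_mono_def)
    then show "u n < u (Suc n)" using Su[of n] Su[of "Suc n"] by linarith
  qed
  have "seq_compact {lo..hi}" by (simp add: compact_imp_seq_compact)
  then obtain b s where b: "b \<in> {lo..hi}" and s: "strict_mono s" and lim: "((x \<circ> u) \<circ> s) \<longlonglongrightarrow> b"
    using range unfolding seq_compact_def by (metis comp_apply)
  have "(\<lambda>n. f (((x \<circ> u) \<circ> s) n)) \<longlonglongrightarrow> f b"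
    using continuous_on_tendsto_compose[OF cont lim b] range by auto
  moreover have "(\<lambda>n. f (((x \<circ> u) \<circ> s) n)) = (x \<circ> r) \<circ> (Suc \<circ> s)"
    by (auto simp: Su simp flip: step)
  moreover have "strict_mono (Suc \<circ> s)" using s by (simp add: strict_mono_def)
  then have "((x \<circ> r) \<circ> (Suc \<circ> s)) \<longlonglongrightarrow> l" using r(2) by (intro LIMSEQ_subseq_LIMSEQ[where X = "x \<circ> r"])
  ultimately have "f b = l" using LIMSEQ_unique by metis
  then show ?thesis
    using that[of "u \<circ> s" b] b lim strict_mono_o[OF u s] by (simp add: o_assoc)
qed

text \<open>
  The least and the greatest subsequential limit of the orbit are values \<open>f b\<close> and \<open>f a\<close> at
  subsequential limits; unless both are \<open>p\<close>, \<open>a < p < b\<close> contradicts \<open>no_swap\<close>.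
\<close>

lemma orbit_tendsto_fixed_point:
  fixes x :: "nat \<Rightarrow> real"
  assumes cont: "continuous_on {lo..hi} f"
    and range: "\<And>t. x t \<in> {lo..hi}"
    and step: "\<And>t. x (Suc t) = f (x t)"
    and fix_p: "f p = p"
    and below: "\<And>u. u \<in> {lo..hi} \<Longrightarrow> u < p \<Longrightarrow> u < f u"
    and above: "\<And>u. u \<in> {lo..hi} \<Longrightarrow> p < u \<Longrightarrow> f u < u"
    and no_swap: "\<And>u v. u \<in> {lo..hi} \<Longrightarrow> v \<in> {lo..hi} \<Longrightarrow> u < v \<Longrightarrow> v \<le> f u \<Longrightarrow> u < f v"
  shows "x \<longlonglongrightarrow> p"
proof -
  obtain l L r s where r: "strict_mono r" "(x \<circ> r) \<longlonglongrightarrow> l"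
    and s: "strict_mono s" "(x \<circ> s) \<longlonglongrightarrow> L"
    and bd: "\<And>q a. strict_mono q \<Longrightarrow> (x \<circ> q) \<longlonglongrightarrow> a \<Longrightarrow> l \<le> a \<and> a \<le> L"
    and conv: "l = L \<Longrightarrow> x \<longlonglongrightarrow> l"
    by (rule bounded_sequence_extreme_subseq_limits[where x = x and lo = lo and hi = hi, OF range]) (rule that)
  obtain b where b: "b \<in> {lo..hi}" "f b = l" "l \<le> b" "b \<le> L"
    by (rule orbit_limit_has_preimage_limit[where f = f and x = x, OF cont range step r]) (use bd in blast)
  obtain a where a: "a \<in> {lo..hi}" "f a = L" "l \<le> a" "a \<le> L"
    by (rule orbit_limit_has_preimage_limit[where f = f and x = x, OF cont range step s]) (use bd in blast)
  have "p \<le> l"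
  proof (rule ccontr)
    assume "\<not> p \<le> l"
    then have "p < b" using below[of b] b fix_p by (cases b p rule: linorder_cases) auto
    moreover from this have "a < p" using above[of a] a b fix_p
      by (cases a p rule: linorder_cases) auto
    ultimately show False using no_swap[of a b] a b by auto
  qed
  moreover have "L \<le> p"
    using above[of a] a \<open>p \<le> l\<close> fix_p by (cases a p rule: linorder_cases) auto
  ultimately have "l = p" "L = p" using a by linarith+
  then show ?thesis using conv by simp
qed

section \<open>The excess delay and the update map on the unit interval\<close>

lemma affine_pos_on_unit_interval:
  fixes u v t :: real
  assumes "0 \<le> t" "t \<le> 1" "0 < u" "0 < u + v"
  shows "0 < u + v * t"
proof (cases "t = 1")
  case False
  have "u + v * t = (1 - t) * u + t * (u + v)" by (simp add: algebra_simps)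
  also have "\<dots> > 0" using assms False by (intro add_pos_nonneg mult_pos_pos mult_nonneg_nonneg) auto
  finally show ?thesis .
qed (use assms in simp)

text \<open>This is E[T(p)] - E[X] for a stable queue, with \<open>a\<close> = E[X_e] - E[X],
  \<open>b\<close> = lambda E[X_e] (the load at \<open>p = 1\<close>) and \<open>c\<close> = lambda
  E[X_e^2] / 2.\<close>

definition excess_delay :: "real \<Rightarrow> real \<Rightarrow> real \<Rightarrow> real \<Rightarrow> real" where
  "excess_delay a b c p = a + c * p / (1 - b * p)"

text \<open>\<open>k\<close> stands for \<open>(c2 - c1) / \<theta>up\<close>, so that
  \<open>k / D p\<close> is the threshold type in units of \<open>\<theta>up\<close>.
  \<open>stable\<close> is the ratio condition with denominators cleared, using D'(1) = c / (1 -
  b)^2 and D(1) = a + c / (1 - b).\<close>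

locale shared_dynamics =
  fixes a b c k \<alpha> :: real
  assumes a: "0 < a" and b: "0 < b" "b < 1" and c: "0 \<le> c" and k: "0 < k"
    and \<alpha>: "0 < \<alpha>" "\<alpha> \<le> 1"
    and stable: "c * (b - (1 - \<alpha>)) < a * (1 - b)\<^sup>2"
begin

abbreviation D where "D \<equiv> excess_delay a b c"

definition h where "h p = min 1 (k / D p)"

definition f where "f p = (1 - \<alpha>) * p + \<alpha> * h p"

lemma idle_pos: "0 < 1 - b * p" if "p \<in> {0..1}"
proof -
  have "b * p \<le> b * 1" using b that by (intro mult_left_mono) auto
  then show ?thesis using b by linarith
qed

lemma D_pos: "0 < D p" if "p \<in> {0..1}"
  using a c idle_pos[OF that] that by (auto simp: excess_delay_def intro!: add_pos_nonneg)

lemma D_mono: "D p \<le> D q" if "p \<in> {0..1}" "q \<in> {0..1}" "p \<le> q"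
  using that c b idle_pos unfolding excess_delay_def
  by (intro add_left_mono frac_le mult_left_mono) auto

lemma h_pos: "0 < h p" if "p \<in> {0..1}"
  using D_pos[OF that] k by (simp add: h_def)

lemma h_le_1: "h p \<le> 1"
  by (simp add: h_def)

lemma h_antimono: "h q \<le> h p" if "p \<in> {0..1}" "q \<in> {0..1}" "p \<le> q"
proof -
  have "k / D q \<le> k / D p" using D_mono[OF that] D_pos that k by (intro divide_left_mono) auto
  then show ?thesis by (simp add: h_def)
qed

text \<open>Multiplying by \<open>D\<close> turns the decreasing, truncated \<open>h\<close> into
  \<open>min (D p) k\<close>, which is nondecreasing in \<open>p\<close>. This spares
  \<open>no_swap\<close> a case split on the truncation.\<close>

lemma h_times_D: "h p * D p = min (D p) k" if "p \<in> {0..1}"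
  using D_pos[OF that] by (auto simp: h_def min_def field_simps)

lemma continuous_on_h: "continuous_on {0..1} h"
proof -
  have "continuous_on {0..1} D" unfolding excess_delay_def
    using idle_pos by (intro continuous_intros) force
  then show ?thesis unfolding h_def using D_pos by (intro continuous_intros) force+
qed

lemma continuous_on_f: "continuous_on {0..1} f"
  unfolding f_def by (intro continuous_intros continuous_on_h)

lemma f_in: "f p \<in> {0..1}" if "p \<in> {0..1}"
proof -
  have "0 \<le> f p" using h_pos[OF that] that \<alpha> by (simp add: f_def)
  moreover have "f p \<le> (1 - \<alpha>) * 1 + \<alpha> * 1"
    unfolding f_def using that \<alpha> h_le_1 by (intro add_mono mult_left_mono) auto
  ultimately show ?thesis by simp
qed

text \<open>
  The left-hand side is affine in each of \<open>u\<close> and \<open>v\<close>, so it suffices to check the vertices of the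
  unit square; \<open>stable\<close> enters at \<open>(1, 1)\<close>.
\<close>

lemma swap_form_pos:
  assumes "u \<in> {0..1}" "v \<in> {0..1}"
  shows "0 < a * (1 - b * u) * (1 - b * v) * (2 - \<alpha>) +
    c * ((1 - \<alpha>) * (u + v) - (2 - \<alpha>) * b * u * v)"
proof -
  define P where "P u v = a * (1 - b * u) * (1 - b * v) * (2 - \<alpha>) +
    c * ((1 - \<alpha>) * (u + v) - (2 - \<alpha>) * b * u * v)" for u v
  have affine: "P u v = P u 0 + (P u 1 - P u 0) * v" for u v
    unfolding P_def by algebra
  have sym: "P u v = P v u" for u v unfolding P_def by algebra
  have P00: "0 < P 0 0" using a \<alpha> by (simp add: P_def)
  have P10: "0 < P 1 0" using a b c \<alpha> by (auto simp: P_def intro!: add_pos_nonneg mult_pos_pos)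
  \<comment> \<open>\<open>P 1 1\<close> equals \<open>2 - \<alpha>\<close> times the slack in
    \<open>stable\<close>, plus the nonnegative remainder
    \<open>c * \<alpha> * (1 - \<alpha>)\<close>.\<close>
  have "c * (b - (1 - \<alpha>)) * (2 - \<alpha>) < a * (1 - b)\<^sup>2 * (2 - \<alpha>)"
    using stable \<alpha> by (intro mult_strict_right_mono) auto
  moreover have "P 1 1 = a * (1 - b)\<^sup>2 * (2 - \<alpha>) - c * (b - (1 - \<alpha>)) * (2 - \<alpha>) + c * \<alpha> * (1 - \<alpha>)"
    unfolding P_def by algebra
  moreover have "0 \<le> c * \<alpha> * (1 - \<alpha>)" using c \<alpha> by simp
  ultimately have P11: "0 < P 1 1" by linarith
  have edge: "0 < P w 0" "0 < P w 1" if "w \<in> {0..1}" for w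
    using affine_pos_on_unit_interval[of w "P 0 0" "P 0 1 - P 0 0"]
      affine_pos_on_unit_interval[of w "P 1 0" "P 1 1 - P 1 0"]
      affine[of 0 w] affine[of 1 w] sym[of w] sym[of 0 1] P00 P10 P11 that by auto
  have "0 < P u v"
    using affine_pos_on_unit_interval[of v "P u 0" "P u 1 - P u 0"] affine[of u v] edge[of u] assms
    by simp
  then show ?thesis by (simp add: P_def)
qed

lemma no_swap:
  assumes u: "u \<in> {0..1}" and v: "v \<in> {0..1}" and "u < v" "v \<le> f u"
  shows "u < f v"
proof (rule ccontr)
  assume "\<not> u < f v"
  then have fv: "\<alpha> * h v \<le> u - (1 - \<alpha>) * v" by (simp add: f_def)
  have fu: "v - (1 - \<alpha>) * u \<le> \<alpha> * h u" using assms by (simp add: f_def)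
  have "(v - (1 - \<alpha>) * u) * D u \<le> \<alpha> * (h u * D u)"
    using mult_right_mono[OF fu, of "D u"] D_pos[OF u] by simp
  also have "\<dots> \<le> \<alpha> * (h v * D v)"
    using D_mono[OF u v] \<open>u < v\<close> \<alpha> unfolding h_times_D[OF u] h_times_D[OF v]
    by (intro mult_left_mono min.mono) auto
  also have "\<dots> \<le> (u - (1 - \<alpha>) * v) * D v"
    using mult_right_mono[OF fv, of "D v"] D_pos[OF v] by simp
  \<comment> \<open>Clearing the positive denominators leaves a polynomial inequality, whose left
    side factors into \<open>v - u\<close> and the form of \<open>swap_form_pos\<close>.\<close>
  finally have "((v - (1 - \<alpha>) * u) * D u - (u - (1 - \<alpha>) * v) * D v)
      * ((1 - b * u) * (1 - b * v)) \<le> 0"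
    using idle_pos[OF u] idle_pos[OF v] by (intro mult_nonpos_nonneg) auto
  also have "((v - (1 - \<alpha>) * u) * D u - (u - (1 - \<alpha>) * v) * D v) * ((1 - b * u) * (1 - b * v)) =
      (v - (1 - \<alpha>) * u) * (D u * (1 - b * u)) * (1 - b * v)
      - (u - (1 - \<alpha>) * v) * (D v * (1 - b * v)) * (1 - b * u)" by algebra
  also have "D u * (1 - b * u) = a * (1 - b * u) + c * u"
    using idle_pos[OF u] by (simp add: excess_delay_def field_simps)
  also have "D v * (1 - b * v) = a * (1 - b * v) + c * v"
    using idle_pos[OF v] by (simp add: excess_delay_def field_simps)
  also have "(v - (1 - \<alpha>) * u) * (a * (1 - b * u) + c * u) * (1 - b * v)
      - (u - (1 - \<alpha>) * v) * (a * (1 - b * v) + c * v) * (1 - b * u) =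
     (v - u) * (a * (1 - b * u) * (1 - b * v) * (2 - \<alpha>) +
    c * ((1 - \<alpha>) * (u + v) - (2 - \<alpha>) * b * u * v))" by algebra
  finally show False
    using mult_pos_pos[OF _ swap_form_pos[OF u v], of "v - u"] \<open>u < v\<close> by simp
qed

text \<open>Since \<open>h\<close> is antitone, \<open>h u - u\<close> is strictly decreasing and
  changes sign exactly once. \<open>f u - u\<close> is \<open>\<alpha>\<close> times it, so
  \<open>f\<close> has the same fixed point and moves every other point towards it, possibly
  overshooting.\<close>

lemma fixed_point_global_attractor:
  obtains p where "p \<in> {0..1}" "h p = p" "\<And>q. q \<in> {0..1} \<Longrightarrow> h q = q \<Longrightarrow> q = p"
    "\<And>x. x 0 \<in> {0..1} \<Longrightarrow> (\<And>t. x (Suc t) = f (x t)) \<Longrightarrow> x \<longlonglongrightarrow> p"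
proof -
  have "\<exists>p\<ge>0. p \<le> 1 \<and> p - h p = 0"
    using h_pos[of 0] h_le_1[of 1]
    by (intro IVT' continuous_intros continuous_on_h) auto
  then obtain p where p: "p \<in> {0..1}" "h p = p" by auto
  have below: "u < h u" if "u \<in> {0..1}" "u < p" for u using h_antimono[of u p] p that by auto
  have above: "h u < u" if "u \<in> {0..1}" "p < u" for u using h_antimono[of p u] p that by auto
  have f: "f u - u = \<alpha> * (h u - u)" for u by (simp add: f_def algebra_simps)
  show ?thesis
  proof (rule that[OF p])
    fix q assume "q \<in> {0..1}" "h q = q"
    then show "q = p" using below[of q] above[of q] by (cases q p rule: linorder_cases) auto
  next
    fix x :: "nat \<Rightarrow> real" assume x0: "x 0 \<in> {0..1}" and step: "\<And>t. x (Suc t) = f (x t)"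
    have range: "x t \<in> {0..1}" for t by (induction t) (simp_all only: x0 step f_in)
    show "x \<longlonglongrightarrow> p"
    proof (rule orbit_tendsto_fixed_point[where f = f and x = x and p = p, OF continuous_on_f range step])
      show "f p = p" using f[of p] p by simp
      show "u < f u" if "u \<in> {0..1}" "u < p" for u
        using mult_pos_pos[of \<alpha> "h u - u"] below[OF that] f[of u] \<alpha>(1) by linarith
      show "f u < u" if "u \<in> {0..1}" "p < u" for u
        using mult_pos_neg[of \<alpha> "h u - u"] above[OF that] f[of u] \<alpha>(1) by linarith
    qed (rule no_swap)
  qed
qed

end

section \<open>From the queueing model to the parameters of the dynamics\<close>

lemma type_cdf_eq:
  assumes "0 < \<theta>up" "0 \<le> y"
  shows "type_cdf \<theta>up y = min 1 (y / \<theta>up)"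
proof -
  have "{0..\<theta>up} \<inter> {..y} = {0..min \<theta>up y}" by auto
  then show ?thesis
    using assms unfolding type_cdf_def cdf_def measure_def
    by (auto simp: divide_ennreal min_def)
qed

lemma (in prob_space) expectation_pos_if_AE_pos:
  fixes W :: "'a \<Rightarrow> real"
  assumes "integrable M W" "AE \<omega> in M. 0 < W \<omega>"
  shows "0 < expectation W"
proof -
  have "expectation (\<lambda>\<omega>. - W \<omega>) < 0"
    using assms by (intro expectation_less) auto
  then show ?thesis by simp
qed

lemma (in interrupted_service) mean_effective_gt:
  "0 < expectation X" "expectation X < expectation (effective_service X R Y Z)"
proof -
  show X: "0 < expectation X" by (intro expectation_pos_if_AE_pos integrable_X pos_X)
  have "0 < expectation (Y 0)" "0 < expectation (Z 0)"
    by (intro expectation_pos_if_AE_pos integrable_Y pos_Y integrable_Z pos_Z)+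
  then show "expectation X < expectation (effective_service X R Y Z)"
    unfolding mean_effective using X by (simp add: algebra_simps)
qed

text \<open>\<open>m\<close> is arbitrary here: it cancels against the constant term
  \<open>m1 - m\<close>.\<close>

lemma mean_delay_eq_excess_delay:
  assumes "lam * p < 1 / m1"
  shows "mean_delay lam m1 m2 p = ereal (m + excess_delay (m1 - m) (lam * m1) (lam * m2 / 2) p)"
proof -
  have "lam * p * m2 / (2 * (1 - lam * p * m1)) = lam * m2 / 2 * p / (1 - lam * m1 * p)"
    by (simp add: mult_ac)
  then show ?thesis using assms by (simp add: mean_delay_def excess_delay_def)
qed

lemma excess_delay_has_derivative:
  assumes "b * p \<noteq> 1"
  shows "(excess_delay a b c has_field_derivative c / (1 - b * p)\<^sup>2) (at p)"
  unfolding excess_delay_def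
  by (rule derivative_eq_intros refl | use assms in force)+
    (use assms in \<open>simp add: field_simps power2_eq_square\<close>)

lemma delay_ratio_mean_delay:
  assumes "0 < lam" "0 < m1" "lam * m1 < 1" "0 < excess_delay (m1 - m) (lam * m1) (lam * m2 / 2) 1"
  shows "delay_ratio (mean_delay lam m1 m2) m =
    ereal (lam * m2 / 2 / (1 - lam * m1)\<^sup>2 / excess_delay (m1 - m) (lam * m1) (lam * m2 / 2) 1)"
proof -
  let ?D = "excess_delay (m1 - m) (lam * m1) (lam * m2 / 2)"
  have fin: "lam * 1 < 1 / m1" using assms by (simp add: field_simps)
  have T: "mean_delay lam m1 m2 1 = ereal (m + ?D 1)" by (rule mean_delay_eq_excess_delay[OF fin])
  \<comment> \<open>The derivative at 1 also sees points \<open>p > 1\<close>; strict stability at 1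
    persists nearby, so the finite formula holds in a whole neighbourhood.\<close>
  have "\<forall>\<^sub>F p in nhds 1. lam * p < 1 / m1"
    by (rule order_tendstoD(2)[OF _ fin]) (intro tendsto_mult tendsto_const filterlim_ident)
  then have "\<forall>\<^sub>F p in nhds 1. real_of_ereal (mean_delay lam m1 m2 p) = m + ?D p"
    by eventually_elim (simp add: mean_delay_eq_excess_delay[where m = m])
  then have "deriv (\<lambda>p. real_of_ereal (mean_delay lam m1 m2 p)) 1 = deriv (\<lambda>p. m + ?D p) 1"
    by (rule deriv_cong_ev) simp
  also have "\<dots> = lam * m2 / 2 / (1 - lam * m1)\<^sup>2"
    using excess_delay_has_derivative[of "lam * m1" 1 "m1 - m" "lam * m2 / 2"] assms
    by (intro DERIV_imp_deriv) (auto intro!: derivative_eq_intros)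
  finally show ?thesis using assms(4) by (simp add: delay_ratio_def T)
qed

text \<open>The deviation from \<open>q\<close> shrinks by the factor \<open>1 - \<alpha>\<close> at
  each step. The lemma serves the sum of the two fractions, whose target is constant.\<close>

lemma relaxation_tendsto:
  fixes s :: "nat \<Rightarrow> real"
  assumes "\<And>t. s (Suc t) = (1 - \<alpha>) * s t + \<alpha> * q" "\<alpha> \<in> {0<..1}"
  shows "s \<longlonglongrightarrow> q"
proof -
  have "s t = q + (1 - \<alpha>) ^ t * (s 0 - q)" for t
  proof (induction t)
    case (Suc t)
    then show ?case unfolding assms(1) Suc.IH by (simp add: algebra_simps)
  qed simp
  then have "s = (\<lambda>t. q + (1 - \<alpha>) ^ t * (s 0 - q))" by (rule ext)
  moreover have "(\<lambda>t. q + (1 - \<alpha>) ^ t * (s 0 - q)) \<longlonglongrightarrow> q + 0 * (s 0 - q)"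
    using assms(2) by (intro tendsto_intros LIMSEQ_power_zero) auto
  ultimately show ?thesis by simp
qed

theorem theorem4:
  fixes M :: "'a measure"
    and X R :: "'a \<Rightarrow> real" and Y Z :: "nat \<Rightarrow> 'a \<Rightarrow> real"
    and lam V \<theta>up c1 c2 \<alpha> m m1 m2 :: real
    and T :: "real \<Rightarrow> ereal"
    and p1 p2 :: "nat \<Rightarrow> real"
  assumes service: "interrupted_service M X R Y Z"
    and m: "m = integral\<^sup>L M X"
    and m1: "m1 = integral\<^sup>L M (effective_service X R Y Z)"
    and m2: "m2 = integral\<^sup>L M (\<lambda>\<omega>. (effective_service X R Y Z \<omega>)\<^sup>2)"
    and T: "T = mean_delay lam m1 m2"
    and pos: "lam > 0" "V > 0" "\<theta>up > 0"
    and prices: "c1 \<ge> 0" "c2 \<ge> 0"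
    and threshold: "\<forall>\<^sub>F \<epsilon> in at_right 0.
          0 < theta_bar T m c1 c2 (p_eps lam m1 \<epsilon>) \<and>
          theta_bar T m c1 c2 (p_eps lam m1 \<epsilon>) < theta2_star V c2 m"
    and alpha: "\<alpha> \<in> {0<..1}"
    and start: "p1 0 \<in> {0..1}" "p2 0 \<in> {0..1}"
    and dynamics: "\<And>t. (p1 (Suc t), p2 (Suc t)) =
          (1 - \<alpha>) *\<^sub>R (p1 t, p2 t) + \<alpha> *\<^sub>R best_response \<theta>up T m V c1 c2 (p1 t)"
    and ratio: "delay_ratio T m < ereal (1 / \<alpha>)"
  shows "\<exists>p1s p2s. equilibrium \<theta>up T m V c1 c2 (p1s, p2s) \<and>
           (\<forall>q1 q2. equilibrium \<theta>up T m V c1 c2 (q1, q2) \<longrightarrow> (q1, q2) = (p1s, p2s)) \<and>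
           (\<lambda>t. (p1 t, p2 t)) \<longlonglongrightarrow> (p1s, p2s)"
proof -
  interpret interrupted_service M X R Y Z by (rule service)
  have m_pos: "0 < m" and m_less: "m < m1" using mean_effective_gt by (simp_all add: m m1)
  have m2_nonneg: "0 \<le> m2" unfolding m2 by (rule integral_nonneg_AE) simp
  \<comment> \<open>An overloaded queue would give \<open>delay_ratio\<close> the value
    \<open>\<infinity>\<close>, so the ratio condition itself enforces stability at full
    participation.\<close>
  have "T 1 \<noteq> \<infinity>" using ratio by (auto simp: delay_ratio_def)
  then have load: "lam * m1 < 1"
    using m_pos m_less by (auto simp: T mean_delay_def field_simps split: if_splits)
  define a b c where "a = m1 - m" and "b = lam * m1" and "c = lam * m2 / 2"
  let ?D = "excess_delay a b c"
  have abc: "0 < a" "0 < b" "b < 1" "0 \<le> c"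
    using pos m_pos m_less m2_nonneg load by (auto simp: a_def b_def c_def)
  have fin: "lam * p < 1 / m1" if "p \<le> 1" for p
  proof -
    have "b * p \<le> b * 1" using that abc by (intro mult_left_mono) auto
    then show ?thesis using abc(3) m_pos m_less by (simp add: b_def field_simps)
  qed
  have D1: "0 < ?D 1" using abc by (simp add: excess_delay_def add_pos_nonneg)
  have bar: "theta_bar T m c1 c2 p = (c2 - c1) / ?D p" if "p \<le> 1" "?D p \<noteq> 0" for p
    using mean_delay_eq_excess_delay[OF fin[OF that(1)], of m2 m] that(2)
    by (simp add: theta_bar_def T a_def b_def c_def)
  \<comment> \<open>As \<open>b < 1\<close>, \<open>p_eps\<close> equals 1 for all small \<epsilon>.
    The threshold condition thus becomes a statement about \<open>p = 1\<close>, and its positivity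
    part yields \<open>c1 < c2\<close>.\<close>
  have "\<forall>\<^sub>F \<epsilon> in at_right 0. \<epsilon> < 1 / b - 1"
    using abc by (intro order_tendstoD(2)[OF tendsto_ident_at]) (auto simp: field_simps)
  with threshold have "\<forall>\<^sub>F \<epsilon> in at_right (0::real). 0 < theta_bar T m c1 c2 1"
    by eventually_elim (auto simp: p_eps_def b_def min_def split: if_splits)
  then have "0 < theta_bar T m c1 c2 1" by (simp add: eventually_const_iff)
  then have c12: "c1 < c2" using D1 by (simp add: bar zero_less_divide_iff)
  \<comment> \<open>Multiplying out the ratio condition gives \<open>stable\<close>: moving
    \<open>c * (1 - b)\<close> to the left turns \<open>c * \<alpha>\<close> into
    \<open>c * (b - (1 - \<alpha>))\<close>.\<close>
  have "c / (1 - b)\<^sup>2 / ?D 1 < 1 / \<alpha>"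
    using ratio delay_ratio_mean_delay[of lam m1 m m2] pos m_pos m_less load D1
    by (simp add: T a_def b_def c_def)
  then have "c * \<alpha> < (1 - b)\<^sup>2 * ?D 1"
    using alpha abc D1 by (simp add: field_simps)
  also have "\<dots> = a * (1 - b)\<^sup>2 + c * (1 - b)"
    using abc by (simp add: excess_delay_def power2_eq_square field_simps)
  finally interpret S: shared_dynamics a b c "(c2 - c1) / \<theta>up" \<alpha>
    using abc alpha pos c12 by unfold_locales (auto simp: algebra_simps)
  have F: "type_cdf \<theta>up (theta_bar T m c1 c2 p) = S.h p" if "p \<in> {0..1}" for p
    using S.D_pos[OF that] that pos c12 bar[of p]
    by (simp add: type_cdf_eq S.h_def mult.commute)
  define q where "q = type_cdf \<theta>up (theta2_star V c2 m)"
  have br: "best_response \<theta>up T m V c1 c2 p = (S.h p, q - S.h p)" if "p \<in> {0..1}" for p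
    using F[OF that] by (simp add: best_response_def q_def)
  have p1_in: "p1 t \<in> {0..1}" for t
  proof (induction t)
    case (Suc t)
    have "p1 (Suc t) = S.f (p1 t)" using dynamics[of t] br[OF Suc] by (simp add: S.f_def)
    then show ?case using S.f_in[OF Suc] by simp
  qed (rule start)
  have step: "p1 (Suc t) = S.f (p1 t)" "p2 (Suc t) = (1 - \<alpha>) * p2 t + \<alpha> * (q - S.h (p1 t))" for t
    using dynamics[of t] br[OF p1_in] by (simp_all add: S.f_def)
  obtain p where p: "p \<in> {0..1}" "S.h p = p" and uniq: "\<And>r. r \<in> {0..1} \<Longrightarrow> S.h r = r \<Longrightarrow> r = p"
    and conv: "\<And>x. x 0 \<in> {0..1} \<Longrightarrow> (\<And>t. x (Suc t) = S.f (x t)) \<Longrightarrow> x \<longlonglongrightarrow> p"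
    using S.fixed_point_global_attractor by blast
  have p1_lim: "p1 \<longlonglongrightarrow> p" by (rule conv[OF start(1) step(1)])
  \<comment> \<open>The terms in \<open>S.h (p1 t)\<close> cancel in the sum, leaving the constant
    target \<open>q\<close>; the limit of \<open>p2\<close> then follows by subtraction.\<close>
  have "(\<lambda>t. p1 t + p2 t) \<longlonglongrightarrow> q"
    by (rule relaxation_tendsto[OF _ alpha]) (simp add: step S.f_def algebra_simps)
  from tendsto_diff[OF this p1_lim] have p2_lim: "p2 \<longlonglongrightarrow> q - p" by simp
  show ?thesis
  proof (intro exI conjI allI impI)
    show "equilibrium \<theta>up T m V c1 c2 (p, q - p)"
      using p br[OF p(1)] by (simp add: equilibrium_def)
    \<comment> \<open>The first coordinate of an equilibrium is a fixed point of \<open>S.h\<close>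
      and determines the second.\<close>
    show "(q1, q2) = (p, q - p)" if "equilibrium \<theta>up T m V c1 c2 (q1, q2)" for q1 q2
      using that br[of q1] uniq[of q1] p by (auto simp: equilibrium_def)
    show "(\<lambda>t. (p1 t, p2 t)) \<longlonglongrightarrow> (p, q - p)" by (intro tendsto_Pair p1_lim p2_lim)
  qed
qed

end
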